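(* Let $s,t\ge 2$ be integers. Let $G$ be a graph on a vertex set $V$ with a fixed partition $V=V_1\cup\cdots\cup V_s$, where $|V_i|=n$ for all $i\in[s]$. If $G$ is balanced $K_{st}$-free, then $$|G| \le \frac{(sn)^2}{2}-\frac{n^2}{2(t-1)}+s^2 n.$$
   Context: Graphs are finite and simple, $|G|$ denotes the number of edges of $G$, and edges of $G$ may lie inside the parts $V_i$ as well as between them. With respect to the fixed partition $V=V_1\cup\cdots\cup V_s$, a balanced $K_{st}$ in $G$ is a complete subgraph $K\cong K_{st}$ of $G$ with $|V(K)\cap V_i|=t$ for every $i\in[s]$. $G$ is balanced $K_{st}$-free if it contains no balanced $K_{st}$. *)

theory Defs
  imports Complex_Main "HOL-Library.Disjoint_Sets" "HOL-Library.Ramsey"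
begin

(* A graph is a vertex set V together with a set E of two-element subsets of V,
   so that card E is the number of (undirected) edges. *)
definition finite_simple_graph :: "'a set \<Rightarrow> 'a set set \<Rightarrow> bool" where
  "finite_simple_graph V E \<longleftrightarrow> finite V \<and> E \<subseteq> [V]\<^bsup>2\<^esup>"

definition indexed_partition :: "'a set \<Rightarrow> nat \<Rightarrow> (nat \<Rightarrow> 'a set) \<Rightarrow> bool" where
  "indexed_partition V s P \<longleftrightarrow> disjoint_family_on P {1..s} \<and> (\<Union>i\<in>{1..s}. P i) = V"

(* A complete subgraph is determined by its vertex set K. *)
definition balanced_clique ::
  "'a set \<Rightarrow> 'a set set \<Rightarrow> nat \<Rightarrow> (nat \<Rightarrow> 'a set) \<Rightarrow> nat \<Rightarrow> 'a set \<Rightarrow> bool" where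
  "balanced_clique V E s P t K \<longleftrightarrow>
     K \<in> nsets V (s * t) \<and> clique K E \<and> (\<forall>i\<in>{1..s}. card (K \<inter> P i) = t)"

definition balanced_clique_free ::
  "'a set \<Rightarrow> 'a set set \<Rightarrow> nat \<Rightarrow> (nat \<Rightarrow> 'a set) \<Rightarrow> nat \<Rightarrow> bool" where
  "balanced_clique_free V E s P t \<longleftrightarrow> \<not> (\<exists>K. balanced_clique V E s P t K)"

end

theory Submission
  imports Defs
begin

text \<open>
  Write \<open>d v\<close> for the number of vertices not adjacent to \<open>v\<close>, with \<open>v\<close> itself counted. In an
  edge-maximal balanced \<open>K\<^sub>s\<^sub>t\<close>-free graph the degrees of two vertices \<open>u\<close>, \<open>v\<close> of the same part
  differ by at most one: replacing \<open>u\<close> by a non-adjacent clone of \<open>v\<close> creates no balanced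
  clique, because a clique contains at most one of the two clones and they lie in the same part.

  Let \<open>D i\<close> be the maximum of \<open>d\<close> on the \<open>i\<close>-th part. If \<open>(t - 1) * (\<Sum>i. D i) < n\<close>, a balanced
  clique can be built by adding one vertex of each part at a time: the vertices chosen so far exclude
  fewer than \<open>n\<close> vertices altogether. If the remaining sets \<open>F i\<close> had no transversal clique, take
  a minimal set \<open>I\<close> of parts without one. For each \<open>i \<in> I\<close> a transversal clique of the other
  parts of \<open>I\<close> excludes all of \<open>F i\<close>, and summing these inequalities over \<open>i \<in> I\<close> gives
  \<open>(\<Sum>i\<in>I. D i) \<ge> n\<close>. Hence \<open>(t - 1) * (\<Sum>i. D i) \<ge> n\<close>, and summing \<open>d\<close> over all
  vertices yields the bound.
\<close>

section \<open>Building a balanced clique from non-degree bounds\<close>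

definition nbrs :: "'a set set \<Rightarrow> 'a \<Rightarrow> 'a set" where
  "nbrs E v = {u. {u, v} \<in> E}"

text \<open>\<open>\<delta> i\<close> bounds the candidates already lost in part \<open>i\<close>;
  only the total loss matters, so it may be spread unevenly over the parts. The hypotheses pass to
  subsets of \<open>I\<close>, so the induction makes \<open>I\<close> a minimal index set without a
  transversal clique.\<close>

lemma transversal_clique:
  fixes F :: "'i \<Rightarrow> 'a set" and D \<delta> :: "'i \<Rightarrow> nat"
  assumes "finite I" and "finite V"
    and "\<And>i. i \<in> I \<Longrightarrow> F i \<subseteq> V"
    and "\<And>i v. i \<in> I \<Longrightarrow> v \<in> F i \<Longrightarrow> card (V - nbrs E v) \<le> D i"
    and "\<And>i. i \<in> I \<Longrightarrow> n \<le> card (F i) + \<delta> i"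
    and "sum \<delta> I < n" and "sum D I < n"
  shows "\<exists>f. (\<forall>i\<in>I. f i \<in> F i) \<and> (\<forall>i\<in>I. \<forall>j\<in>I. i \<noteq> j \<longrightarrow> {f i, f j} \<in> E)"
  using assms
proof (induction I rule: finite_psubset_induct)
  case (psubset I)
  show ?case
  proof (rule ccontr)
    assume no_transversal: "\<not> ?case"
    then have "I \<noteq> {}" by auto
    have deficit: "n + D i \<le> \<delta> i + sum D I" if i: "i \<in> I" for i
    proof -
      have sums: "sum \<delta> (I - {i}) < n" "sum D (I - {i}) < n"
        using sum_mono2[OF \<open>finite I\<close>, of "I - {i}" \<delta>] sum_mono2[OF \<open>finite I\<close>, of "I - {i}" D]
          psubset.prems(5,6) by auto
      have "\<exists>f. (\<forall>j\<in>I - {i}. f j \<in> F j) \<and>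
          (\<forall>j\<in>I - {i}. \<forall>k\<in>I - {i}. j \<noteq> k \<longrightarrow> {f j, f k} \<in> E)"
        using i by (intro psubset.IH psubset.prems sums) auto
      then obtain f where f: "\<And>j. j \<in> I - {i} \<Longrightarrow> f j \<in> F j"
        "\<And>j k. j \<in> I - {i} \<Longrightarrow> k \<in> I - {i} \<Longrightarrow> j \<noteq> k \<Longrightarrow> {f j, f k} \<in> E"
        by blast
      \<comment> \<open>A vertex of \<open>F i\<close> outside this union would be adjacent to every
        \<open>f j\<close> and would extend \<open>f\<close> to all of \<open>I\<close>.\<close>
      have "F i \<subseteq> (\<Union>j\<in>I - {i}. V - nbrs E (f j))"
      proof (rule ccontr)
        assume "\<not> ?thesis"
        then obtain x where x: "x \<in> F i" "\<And>j. j \<in> I - {i} \<Longrightarrow> {x, f j} \<in> E"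
          using psubset.prems(2)[OF i] by (auto simp: nbrs_def)
        then have "\<forall>j\<in>I. (f(i := x)) j \<in> F j"
          "\<forall>j\<in>I. \<forall>k\<in>I. j \<noteq> k \<longrightarrow> {(f(i := x)) j, (f(i := x)) k} \<in> E"
          using f by (auto simp: insert_commute)
        with no_transversal show False by blast
      qed
      then have "card (F i) \<le> card (\<Union>j\<in>I - {i}. V - nbrs E (f j))"
        using psubset.hyps \<open>finite V\<close> by (intro card_mono) auto
      also have "\<dots> \<le> (\<Sum>j\<in>I - {i}. card (V - nbrs E (f j)))"
        using psubset.hyps by (intro card_UN_le) auto
      also have "\<dots> \<le> sum D (I - {i})"
        using f(1) psubset.prems(3) by (intro sum_mono) auto
      finally show ?thesis
        using psubset.prems(4)[OF i] sum.remove[OF \<open>finite I\<close> i, of D] by linarith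
    qed
    \<comment> \<open>The deficits are summed over \<open>I\<close>. One copy of
      \<open>sum D I\<close> cancels and each of the other \<open>card I - 1\<close> copies is at
      most \<open>n\<close>, which leaves \<open>n \<le> sum \<delta> I\<close>.\<close>
    have "card I * n + sum D I \<le> sum \<delta> I + card I * sum D I"
      using sum_mono[of I "\<lambda>i. n + D i" "\<lambda>i. \<delta> i + sum D I"] deficit
      by (simp add: sum.distrib)
    moreover obtain k where k: "card I = Suc k"
      using \<open>I \<noteq> {}\<close> \<open>finite I\<close> by (metis card_eq_0_iff not0_implies_Suc)
    ultimately have "n + k * n \<le> sum \<delta> I + k * sum D I"
      by simp
    moreover have "k * sum D I \<le> k * n"
      using psubset.prems(6) by simp
    ultimately show False
      using psubset.prems(5) by linarith
  qed
qed

text \<open>In the step from \<open>m\<close> to \<open>Suc m\<close>, the \<open>m\<close> chosen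
  vertices per part exclude at most \<open>m * sum D I\<close> vertices, hence the factor
  \<open>m - 1\<close> in the hypothesis. That factor is 0 at \<open>m = 1\<close>, where the
  transversal still relies on \<open>sum D I < n\<close>.\<close>

lemma balanced_clique_exists:
  fixes P :: "'i \<Rightarrow> 'a set" and D :: "'i \<Rightarrow> nat"
  assumes "finite I" and "finite V" and "E \<subseteq> [V]\<^bsup>2\<^esup>"
    and disj: "disjoint_family_on P I" and V: "(\<Union>i\<in>I. P i) = V"
    and n: "\<And>i. i \<in> I \<Longrightarrow> card (P i) = n"
    and D: "\<And>i v. i \<in> I \<Longrightarrow> v \<in> P i \<Longrightarrow> card (V - nbrs E v) \<le> D i"
    and "sum D I < n" and "(m - 1) * sum D I < n"
  shows "\<exists>K\<subseteq>V. clique K E \<and> (\<forall>i\<in>I. card (K \<inter> P i) = m)"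
  using \<open>(m - 1) * sum D I < n\<close>
proof (induction m)
  case 0
  show ?case by (intro exI[of _ "{}"]) (auto simp: clique_def)
next
  case (Suc m)
  have "(m - 1) * sum D I \<le> m * sum D I" by (intro mult_right_mono) auto
  with Suc obtain K where K: "K \<subseteq> V" "clique K E" "\<And>i. i \<in> I \<Longrightarrow> card (K \<inter> P i) = m"
    by fastforce
  have finP: "finite (P i)" if "i \<in> I" for i
    using that V \<open>finite V\<close> by (metis UN_upper finite_subset)
  have finK: "finite K" using K(1) \<open>finite V\<close> finite_subset by blast
  define F where "F i = {x \<in> P i. \<forall>k\<in>K. {x, k} \<in> E}" for i
  \<comment> \<open>The parts are disjoint, so the losses add up to the size of one set, which the
    non-neighbourhoods of the vertices of \<open>K\<close> cover. Grouping \<open>K\<close> by parts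
    bounds it by the sum of all \<open>m * D i\<close>.\<close>
  have excluded: "(\<Sum>i\<in>I. card (P i - F i)) < n"
  proof -
    have "(\<Sum>i\<in>I. card (P i - F i)) = card (\<Union>i\<in>I. P i - F i)"
      using disj finP \<open>finite I\<close>
      by (intro card_UN_disjoint[symmetric]) (auto simp: disjoint_family_on_def)
    also have "\<dots> \<le> card (\<Union>k\<in>K. V - nbrs E k)"
      using V finK \<open>finite V\<close> by (intro card_mono) (auto simp: F_def nbrs_def)
    also have "\<dots> \<le> (\<Sum>k\<in>K. card (V - nbrs E k))"
      by (intro card_UN_le finK)
    also have "K = (\<Union>i\<in>I. K \<inter> P i)" using K(1) V by auto
    also have "(\<Sum>k\<in>(\<Union>i\<in>I. K \<inter> P i). card (V - nbrs E k))
        = (\<Sum>i\<in>I. \<Sum>k\<in>K \<inter> P i. card (V - nbrs E k))"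
      using disj finP \<open>finite I\<close>
      by (intro sum.UNION_disjoint) (auto simp: disjoint_family_on_def)
    also have "\<dots> \<le> (\<Sum>i\<in>I. m * D i)"
    proof (rule sum_mono)
      fix i assume "i \<in> I"
      then show "(\<Sum>k\<in>K \<inter> P i. card (V - nbrs E k)) \<le> m * D i"
        using sum_bounded_above[of "K \<inter> P i" "\<lambda>k. card (V - nbrs E k)" "D i"] D K(3) by auto
    qed
    also have "\<dots> < n" using Suc.prems by (simp add: sum_distrib_left)
    finally show ?thesis .
  qed
  have "\<exists>f. (\<forall>i\<in>I. f i \<in> F i) \<and> (\<forall>i\<in>I. \<forall>j\<in>I. i \<noteq> j \<longrightarrow> {f i, f j} \<in> E)"
  proof (rule transversal_clique[OF \<open>finite I\<close> \<open>finite V\<close> _ _ _ excluded \<open>sum D I < n\<close>])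
    fix i assume i: "i \<in> I"
    show "F i \<subseteq> V" using i V by (auto simp: F_def)
    show "card (V - nbrs E v) \<le> D i" if "v \<in> F i" for v
      using D[OF i] that by (auto simp: F_def)
    have "card (P i) = card (F i \<union> (P i - F i))"
      by (rule arg_cong[of _ _ card]) (auto simp: F_def)
    also have "\<dots> \<le> card (F i) + card (P i - F i)" by (rule card_Un_le)
    finally show "n \<le> card (F i) + card (P i - F i)" using n[OF i] by simp
  qed
  then obtain f where f: "\<And>i. i \<in> I \<Longrightarrow> f i \<in> P i"
      "\<And>i k. i \<in> I \<Longrightarrow> k \<in> K \<Longrightarrow> {f i, k} \<in> E"
      "\<And>i j. i \<in> I \<Longrightarrow> j \<in> I \<Longrightarrow> i \<noteq> j \<Longrightarrow> {f i, f j} \<in> E"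
    unfolding F_def by blast
  \<comment> \<open>No vertex is adjacent to itself, so a vertex adjacent to all of \<open>K\<close>
    lies outside \<open>K\<close>.\<close>
  have "{x} \<notin> E" for x
    using \<open>E \<subseteq> [V]\<^bsup>2\<^esup>\<close> by (auto simp: nsets_def)
  then have fresh: "f i \<notin> K" if "i \<in> I" for i
    using f(2)[OF that, of "f i"] by auto
  show ?case
  proof (intro exI[of _ "K \<union> f ` I"] conjI ballI)
    show "K \<union> f ` I \<subseteq> V" using K(1) f(1) V by auto
    have "{f i, f j} \<in> E" if "i \<in> I" "j \<in> I" "f i \<noteq> f j" for i j
      using that f(3)[of i j] by auto
    then show "clique (K \<union> f ` I) E"
      using K(2) f(2) by (auto simp: clique_def insert_commute)
    fix i assume i: "i \<in> I"
    have "j = i" if "j \<in> I" "f j \<in> P i" for j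
      using that i f(1)[of j] disj by (auto simp: disjoint_family_on_def)
    then have "(K \<union> f ` I) \<inter> P i = insert (f i) (K \<inter> P i)"
      using i f(1) by auto
    then show "card ((K \<union> f ` I) \<inter> P i) = Suc m"
      using K(3)[OF i] fresh[OF i] finK by simp
  qed
qed

section \<open>Degrees and edge counts\<close>

lemma card_incident_edges:
  assumes "E \<subseteq> [V]\<^bsup>2\<^esup>"
  shows "card {e \<in> E. v \<in> e} = card (nbrs E v)"
proof -
  have "{e \<in> E. v \<in> e} = (\<lambda>u. {u, v}) ` nbrs E v"
    using assms by (fastforce simp: nbrs_def nsets_def card_2_iff insert_commute)
  moreover have "inj_on (\<lambda>u. {u, v}) (nbrs E v)"
    by (auto simp: inj_on_def doubleton_eq_iff)
  ultimately show ?thesis by (simp add: card_image)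
qed

lemma handshake:
  assumes "finite V" and "E \<subseteq> [V]\<^bsup>2\<^esup>"
  shows "(\<Sum>v\<in>V. card (nbrs E v)) = 2 * card E"
proof -
  have "finite E"
    using assms by (meson finite_imp_finite_nsets finite_subset)
  have "(\<Sum>v\<in>V. card {e \<in> E. v \<in> e}) = 2 * card E"
  proof (rule sum_multicount[OF \<open>finite V\<close> \<open>finite E\<close>], rule ballI)
    fix e assume "e \<in> E"
    then have "e \<subseteq> V" "card e = 2" using assms by (auto simp: nsets_def)
    then show "card {v \<in> V. v \<in> e} = 2" by (simp add: Int_absorb1 flip: Int_def)
  qed
  then show ?thesis by (simp add: card_incident_edges[OF assms(2)])
qed

section \<open>Cloning a vertex\<close>

text \<open>The edge set after \<open>u\<close> has become a non-adjacent twin of \<open>v\<close>.\<close>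

definition clone_edges :: "'a \<Rightarrow> 'a \<Rightarrow> 'a set set \<Rightarrow> 'a set set" where
  "clone_edges u v E = {e \<in> E. u \<notin> e} \<union> (\<lambda>w. {w, u}) ` (nbrs E v - {u})"

lemma nbrs_subset:
  assumes "E \<subseteq> [V]\<^bsup>2\<^esup>"
  shows "nbrs E v \<subseteq> V"
  using assms by (auto simp: nbrs_def nsets_def)

lemma clone_edges_subset:
  assumes "E \<subseteq> [V]\<^bsup>2\<^esup>" and "u \<in> V"
  shows "clone_edges u v E \<subseteq> [V]\<^bsup>2\<^esup>"
  using assms nbrs_subset[OF assms(1), of v] by (auto simp: clone_edges_def nsets_def)

text \<open>Cloning trades the edges at \<open>u\<close> for one edge from \<open>u\<close> to each
  neighbour of \<open>v\<close> other than \<open>u\<close>; the summand 1 pays for this exception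
  when \<open>u\<close> and \<open>v\<close> are adjacent.\<close>

lemma card_clone_edges:
  assumes "finite V" and "E \<subseteq> [V]\<^bsup>2\<^esup>"
  shows "card E + card (nbrs E v) \<le> card (clone_edges u v E) + card (nbrs E u) + 1"
proof -
  have finE: "finite E"
    using assms by (meson finite_imp_finite_nsets finite_subset)
  have finN: "finite (nbrs E v)"
    using assms nbrs_subset finite_subset by metis
  have "card E = card {e \<in> E. u \<notin> e} + card {e \<in> E. u \<in> e}"
    using finE by (subst card_Un_disjoint[symmetric]) (auto intro: arg_cong[of _ _ card])
  moreover have "card (clone_edges u v E)
      = card {e \<in> E. u \<notin> e} + card ((\<lambda>w. {w, u}) ` (nbrs E v - {u}))"
    unfolding clone_edges_def using finE finN by (intro card_Un_disjoint) auto
  moreover have "card ((\<lambda>w. {w, u}) ` (nbrs E v - {u})) = card (nbrs E v - {u})"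
    by (intro card_image) (auto simp: inj_on_def doubleton_eq_iff)
  moreover have "card (nbrs E v) \<le> card (nbrs E v - {u}) + 1"
    using diff_card_le_card_Diff[of "{u}" "nbrs E v"] by simp
  ultimately show ?thesis
    using card_incident_edges[OF assms(2), of u] by linarith
qed

text \<open>Trading \<open>u\<close> for \<open>v\<close> turns a balanced clique of the new graph
  into one of the old graph.\<close>

lemma balanced_clique_free_clone_edges:
  assumes "finite V" and "E \<subseteq> [V]\<^bsup>2\<^esup>" and part: "indexed_partition V s P"
    and i: "i \<in> {1..s}" and u: "u \<in> P i" and v: "v \<in> P i" and "u \<noteq> v"
    and free: "balanced_clique_free V E s P t"
  shows "balanced_clique_free V (clone_edges u v E) s P t"
  unfolding balanced_clique_free_def
proof
  assume "\<exists>K. balanced_clique V (clone_edges u v E) s P t K"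
  then obtain K where K: "K \<subseteq> V" "finite K" "card K = s * t" "clique K (clone_edges u v E)"
    "\<And>j. j \<in> {1..s} \<Longrightarrow> card (K \<inter> P j) = t"
    by (auto simp: balanced_clique_def nsets_def)
  have single: "{x} \<notin> E" for x
    using \<open>E \<subseteq> [V]\<^bsup>2\<^esup>\<close> by (auto simp: nsets_def)
  have old: "{x, y} \<in> E" if "{x, y} \<in> clone_edges u v E" "x \<noteq> u" "y \<noteq> u" for x y
    using that by (auto simp: clone_edges_def doubleton_eq_iff)
  have new: "{x, v} \<in> E" if "{x, u} \<in> clone_edges u v E" for x
    using that by (auto simp: clone_edges_def doubleton_eq_iff nbrs_def)
  have vV: "v \<in> V" using part i v by (auto simp: indexed_partition_def)
  show False
  proof (cases "u \<in> K")
    case False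
    then have "clique K E"
      using K(4) old unfolding clique_def by metis
    then show False
      using free K by (auto simp: balanced_clique_free_def balanced_clique_def nsets_def)
  next
    case True
    \<comment> \<open>If \<open>K\<close> contained both clones, the edge \<open>{v, u}\<close>
      would come from a loop \<open>{v, v}\<close> in \<open>E\<close>.\<close>
    have vK: "v \<notin> K"
      using K(4) True \<open>u \<noteq> v\<close> new[of v] single[of v] by (auto simp: clique_def)
    let ?K = "insert v (K - {u})"
    \<comment> \<open>Edges avoiding \<open>u\<close> are old, and each new edge at \<open>u\<close>
      copies an old edge at \<open>v\<close>.\<close>
    have clique: "clique ?K E"
      using K(4) True old new unfolding clique_def
      by (smt (verit) Diff_iff insert_commute insert_iff)
    have "card (?K \<inter> P j) = t" if j: "j \<in> {1..s}" for j
    proof (cases "j = i")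
      case True
      then have "?K \<inter> P j = insert v (K \<inter> P j - {u})" using v by auto
      moreover have "Suc (card (K \<inter> P j - {u})) = card (K \<inter> P j)"
        using \<open>u \<in> K\<close> u True K(2) by (intro card_Suc_Diff1) auto
      ultimately show ?thesis using vK K(2) K(5)[OF j] by simp
    next
      case False
      then have "u \<notin> P j" "v \<notin> P j"
        using part i j u v by (auto simp: indexed_partition_def dest: disjoint_family_onD)
      then have "?K \<inter> P j = K \<inter> P j" by auto
      then show ?thesis using K(5)[OF j] by simp
    qed
    moreover have "card ?K = s * t"
      using vK K(2,3) True by (metis Diff_iff card.insert card_Suc_Diff1 finite_Diff)
    ultimately have "balanced_clique V E s P t ?K"
      using K(1,2) vV clique by (auto simp: balanced_clique_def nsets_def)
    then show False using free by (auto simp: balanced_clique_free_def)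
  qed
qed

section \<open>The bound for edge-maximal graphs\<close>

lemma card_edges_extremal:
  assumes "t \<ge> 2" and "finite V" and E: "E \<subseteq> [V]\<^bsup>2\<^esup>"
    and part: "indexed_partition V s P"
    and n: "\<And>i. i \<in> {1..s} \<Longrightarrow> card (P i) = n"
    and free: "balanced_clique_free V E s P t"
    and maximal: "\<And>E'. E' \<subseteq> [V]\<^bsup>2\<^esup> \<Longrightarrow> balanced_clique_free V E' s P t \<Longrightarrow> card E' \<le> card E"
  shows "real (card E)
    \<le> (real s * real n)\<^sup>2 / 2 - (real n)\<^sup>2 / (2 * (real t - 1)) + real s * real n / 2"
proof -
  let ?d = "\<lambda>v. card (V - nbrs E v)"
  have disj: "disjoint_family_on P {1..s}" and V: "(\<Union>i\<in>{1..s}. P i) = V"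
    using part by (auto simp: indexed_partition_def)
  have finP: "finite (P i)" if "i \<in> {1..s}" for i
    using that V \<open>finite V\<close> by (metis UN_upper finite_subset)
  have finN: "finite (nbrs E v)" for v
    using nbrs_subset[OF E] \<open>finite V\<close> finite_subset by metis
  have d: "?d v + card (nbrs E v) = card V" for v
    using nbrs_subset[OF E, of v] \<open>finite V\<close> finN[of v]
    by (metis card_Diff_subset card_mono le_add_diff_inverse2)
  \<comment> \<open>Making \<open>u\<close> a twin of \<open>v\<close> cannot gain edges, so the
    degree of \<open>v\<close> exceeds that of \<open>u\<close> by at most one.\<close>
  have almost_regular: "?d u \<le> ?d v + 1" if i: "i \<in> {1..s}" and uv: "u \<in> P i" "v \<in> P i" for i u v
  proof (cases "u = v")
    case False
    have "u \<in> V" using i uv V by auto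
    then have "card (clone_edges u v E) \<le> card E"
      using balanced_clique_free_clone_edges[OF \<open>finite V\<close> E part i uv False free]
      by (intro maximal clone_edges_subset E)
    then show ?thesis
      using card_clone_edges[OF \<open>finite V\<close> E, of v u] d[of u] d[of v] by linarith
  qed simp
  \<comment> \<open>The witness is the maximum of \<open>?d\<close> on the part; for an empty part
    any value serves.\<close>
  have "\<exists>b. \<forall>v\<in>P i. ?d v \<le> b \<and> b \<le> ?d v + 1" if i: "i \<in> {1..s}" for i
  proof (cases "P i = {}")
    case False
    then have "Max (?d ` P i) \<in> ?d ` P i"
      using finP[OF i] by (intro Max_in) auto
    then show ?thesis
      using almost_regular[OF i] finP[OF i] by (intro exI[of _ "Max (?d ` P i)"]) auto
  qed simp
  then obtain D where D: "\<And>i v. i \<in> {1..s} \<Longrightarrow> v \<in> P i \<Longrightarrow> ?d v \<le> D i \<and> D i \<le> ?d v + 1"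
    by metis
  let ?D = "sum D {1..s}"
  have cardV: "card V = s * n"
    using card_UN_disjoint[of "{1..s}" P] V disj finP n by (simp add: disjoint_family_on_def)
  have "n \<le> (t - 1) * ?D"
  proof (rule ccontr)
    assume "\<not> ?thesis"
    then have less: "(t - 1) * ?D < n" by simp
    \<comment> \<open>Since \<open>t \<ge> 2\<close>, the negated goal yields both size conditions
      of the clique construction.\<close>
    have "1 * ?D \<le> (t - 1) * ?D" using \<open>t \<ge> 2\<close> by (intro mult_right_mono) auto
    then have "?D < n" using less by linarith
    obtain K where K: "K \<subseteq> V" "clique K E" "\<And>i. i \<in> {1..s} \<Longrightarrow> card (K \<inter> P i) = t"
      using balanced_clique_exists[OF _ \<open>finite V\<close> E disj V n _ \<open>?D < n\<close> less] D by auto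
    have "finite K" using K(1) \<open>finite V\<close> finite_subset by blast
    have "card K = card (\<Union>i\<in>{1..s}. K \<inter> P i)"
      using K(1) V by (intro arg_cong[of _ _ card]) auto
    also have "\<dots> = (\<Sum>i\<in>{1..s}. card (K \<inter> P i))"
      using disj \<open>finite K\<close> by (intro card_UN_disjoint) (auto simp: disjoint_family_on_def)
    finally have "card K = s * t" using K(3) by simp
    then have "balanced_clique V E s P t K"
      using K \<open>finite K\<close> by (simp add: balanced_clique_def nsets_def)
    then show False using free by (auto simp: balanced_clique_free_def)
  qed
  then have "real n \<le> real ((t - 1) * ?D)"
    by (rule of_nat_mono)
  then have "real n / (real t - 1) \<le> real ?D"
    using \<open>t \<ge> 2\<close> by (simp add: divide_le_eq of_nat_diff mult.commute)
  then have "real n * (real n / (real t - 1)) \<le> real n * real ?D"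
    by (intro mult_left_mono) auto
  then have lower: "(real n)\<^sup>2 / (real t - 1) \<le> real n * real ?D"
    by (simp add: power2_eq_square)
  \<comment> \<open>Raising every term by 1 lifts it to at least \<open>D i\<close>. The cost
    \<open>s * n\<close> becomes the error term \<open>s * n / 2\<close> after halving.\<close>
  have "(\<Sum>v\<in>V. ?d v) + s * n = (\<Sum>v\<in>V. ?d v + 1)"
    by (simp only: sum.distrib cardV card_eq_sum[symmetric])
  also have "\<dots> = (\<Sum>i\<in>{1..s}. \<Sum>v\<in>P i. ?d v + 1)"
    unfolding V[symmetric] using disj finP
    by (intro sum.UNION_disjoint) (auto simp: disjoint_family_on_def)
  also have "\<dots> \<ge> (\<Sum>i\<in>{1..s}. n * D i)"
  proof (rule sum_mono)
    fix i assume i: "i \<in> {1..s}"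
    then show "n * D i \<le> (\<Sum>v\<in>P i. ?d v + 1)"
      using sum_bounded_below[of "P i" "D i" "\<lambda>v. ?d v + 1"] D n[OF i] by auto
  qed
  finally have "n * ?D \<le> (\<Sum>v\<in>V. ?d v) + s * n"
    by (simp add: sum_distrib_left)
  \<comment> \<open>Each vertex splits \<open>V\<close> into neighbours and non-neighbours, and the
    degrees sum to twice the number of edges.\<close>
  moreover have "(\<Sum>v\<in>V. ?d v) + 2 * card E = (s * n) * (s * n)"
    by (simp add: d cardV flip: handshake[OF \<open>finite V\<close> E] sum.distrib)
  ultimately have "n * ?D + 2 * card E \<le> (s * n) * (s * n) + s * n"
    by linarith
  then have "real (n * ?D + 2 * card E) \<le> real ((s * n) * (s * n) + s * n)"
    by (rule of_nat_mono)
  then have upper: "real n * real ?D + 2 * real (card E) \<le> (real s * real n)\<^sup>2 + real s * real n"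
    by (simp add: power2_eq_square)
  have "(real n)\<^sup>2 / (real t - 1) + 2 * real (card E)
      \<le> (real s * real n)\<^sup>2 + real s * real n"
    by (rule order_trans[OF add_right_mono[OF lower] upper])
  then have
    "real (card E) \<le> ((real s * real n)\<^sup>2 - (real n)\<^sup>2 / (real t - 1) + real s * real n) / 2"
    by simp
  then show ?thesis
    by (simp add: add_divide_distrib diff_divide_distrib mult.commute)
qed

theorem theorem2p1:
  fixes s t n :: nat
    and V :: "'a set" and E :: "'a set set" and P :: "nat \<Rightarrow> 'a set"
  assumes "s \<ge> 2" and "t \<ge> 2"
    and "finite_simple_graph V E"
    and "indexed_partition V s P"
    and "\<And>i. i \<in> {1..s} \<Longrightarrow> card (P i) = n"
    and "balanced_clique_free V E s P t"
  shows "real (card E)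
    \<le> (real s * real n)\<^sup>2 / 2 - (real n)\<^sup>2 / (2 * (real t - 1)) + (real s)\<^sup>2 * real n"
proof -
  \<comment> \<open>There are finitely many admissible edge sets on \<open>V\<close>, so one of
    maximum size exists; its bound carries over to \<open>E\<close>.\<close>
  let ?A = "{E. E \<subseteq> [V]\<^bsup>2\<^esup> \<and> balanced_clique_free V E s P t}"
  have "finite V" and "E \<in> ?A"
    using assms(3,6) by (auto simp: finite_simple_graph_def)
  have "finite ?A"
    using \<open>finite V\<close> by (auto intro: finite_subset[of _ "Pow ([V]\<^bsup>2\<^esup>)"] finite_imp_finite_nsets)
  then have "Max (card ` ?A) \<in> card ` ?A"
    using \<open>E \<in> ?A\<close> by (intro Max_in) auto
  then obtain M where M: "M \<in> ?A" "card M = Max (card ` ?A)"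
    by force
  have le_M: "card E' \<le> card M" if "E' \<in> ?A" for E'
    using that \<open>finite ?A\<close> M(2) by simp
  have "real (card M)
    \<le> (real s * real n)\<^sup>2 / 2 - (real n)\<^sup>2 / (2 * (real t - 1)) + real s * real n / 2"
    using M(1) le_M by (intro card_edges_extremal[OF assms(2) \<open>finite V\<close> _ assms(4,5)]) auto
  moreover have "real (card E) \<le> real (card M)"
    using le_M[OF \<open>E \<in> ?A\<close>] by simp
  moreover have "real s * real n / 2 \<le> (real s)\<^sup>2 * real n"
  proof -
    have "real s * 1 \<le> real s * real s" using assms(1) by (intro mult_left_mono) auto
    then have "real s / 2 \<le> (real s)\<^sup>2" by (simp add: power2_eq_square)
    then have "real s / 2 * real n \<le> (real s)\<^sup>2 * real n" by (intro mult_right_mono) auto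
    then show ?thesis by simp
  qed
  ultimately show ?thesis by linarith
qed

end
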